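(* Let $F$ be the CDF of a distribution on $\mathbb{R}$ with mean $\mu$ and support $D\subset\mathbb{R}$, where $s_D=\sup D<\infty$. Let $n\ge 1$ and let $\mathbf{X}=(X_1,\dots,X_n)$ be an i.i.d. random sample of size $n$ from $F$. Then for any function $T:D^n\to\mathbb{R}$ and for any $\alpha\in(0,1)$, $$\mathbb{P}_{\mathbf{X}}\big(b^{\alpha}_{D,T}(\mathbf{X})<\mu\big)\le \alpha .$$
   Context: For a vector $\mathbf{v}\in\mathbb{R}^n$ let $v_{(1)}\le\dots\le v_{(n)}$ denote its sorted entries (order statistics). Let $s_D=\sup D$. For $\mathbf{x}\in D^n$ and $\boldsymbol{\ell}\in[0,1]^n$ the induced mean is $$m_D(\mathbf{x},\boldsymbol{\ell})=\sum_{i=1}^{n+1}x_{(i)}(\ell_{(i)}-\ell_{(i-1)})=s_D-\sum_{i=1}^n \ell_{(i)}(x_{(i+1)}-x_{(i)}),$$ with the conventions $\ell_{(0)}=0$, $\ell_{(n+1)}=1$, $x_{(n+1)}=s_D$. For $\mathbf{x}\in D^n$ let $\mathbb{S}_{D,T}(\mathbf{x})=\{\mathbf{y}\in D^n: T(\mathbf{y})\le T(\mathbf{x})\}$, and for $\mathbf{u}\in[0,1]^n$ let $b_{D,T}(\mathbf{x},\mathbf{u})=\sup_{\mathbf{z}\in\mathbb{S}_{D,T}(\mathbf{x})}m_D(\mathbf{z},\mathbf{u})$. Let $\mathbf{U}=(U_1,\dots,U_n)$ have i.i.d. uniform entries on $[0,1]$. For a real random variable $Y$ with CDF $F_Y$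 and $0<p<1$, $Q(p,Y)=\inf\{y\in\mathbb{R}:F_Y(y)\ge p\}$. The bound is $b^{\alpha}_{D,T}(\mathbf{x})=Q(1-\alpha,\,b_{D,T}(\mathbf{x},\mathbf{U}))$, where $\mathbf{x}$ is fixed and only $\mathbf{U}$ is random. *)

theory Defs
  imports "HOL-Probability.Probability"
begin

text \<open>
  Vectors \<open>v \<in> A\<^sup>n\<close> are functions in \<open>{1..n} \<rightarrow>\<^sub>E A\<close>, i.e. they are \<open>undefined\<close> outside \<open>{1..n}\<close>.
\<close>

definition order_stat :: "nat \<Rightarrow> (nat \<Rightarrow> real) \<Rightarrow> nat \<Rightarrow> real" where
  "order_stat n v i = sort (map v [1..<Suc n]) ! (i - 1)"

text \<open>
  The order statistics of \<open>x\<close> extended by \<open>x\<^sub>(\<^sub>n\<^sub>+\<^sub>1\<^sub>) = sup D\<close>, and those of \<open>l\<close> extended by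
  \<open>l\<^sub>(\<^sub>0\<^sub>) = 0\<close> and \<open>l\<^sub>(\<^sub>n\<^sub>+\<^sub>1\<^sub>) = 1\<close>.
\<close>

definition ext_sample :: "nat \<Rightarrow> real set \<Rightarrow> (nat \<Rightarrow> real) \<Rightarrow> nat \<Rightarrow> real" where
  "ext_sample n D x i = (if i = n + 1 then Sup D else order_stat n x i)"

definition ext_level :: "nat \<Rightarrow> (nat \<Rightarrow> real) \<Rightarrow> nat \<Rightarrow> real" where
  "ext_level n l i = (if i = 0 then 0 else if i = n + 1 then 1 else order_stat n l i)"

definition induced_mean :: "nat \<Rightarrow> real set \<Rightarrow> (nat \<Rightarrow> real) \<Rightarrow> (nat \<Rightarrow> real) \<Rightarrow> real" where
  "induced_mean n D x l =
     (\<Sum>i=1..n+1. ext_sample n D x i * (ext_level n l i - ext_level n l (i - 1)))"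

lemma induced_mean_alt:
  "induced_mean n D x l =
     Sup D - (\<Sum>i=1..n. ext_level n l i * (ext_sample n D x (i + 1) - ext_sample n D x i))"
proof -
  have "(\<Sum>i=1..k+1. f i * (g i - g (i - 1)))
      = f (k + 1) * g (k + 1) - f 1 * g 0 - (\<Sum>i=1..k. g i * (f (i + 1) - f i))"
    for f g :: "nat \<Rightarrow> real" and k
    by (induction k) (simp_all add: algebra_simps)
  from this[of "ext_sample n D x" "ext_level n l" n] show ?thesis
    by (simp add: induced_mean_def ext_sample_def ext_level_def)
qed

definition sublevel :: "nat \<Rightarrow> real set \<Rightarrow> ((nat \<Rightarrow> real) \<Rightarrow> real) \<Rightarrow> (nat \<Rightarrow> real) \<Rightarrow> (nat \<Rightarrow> real) set"
  where "sublevel n D T x = {y \<in> {1..n} \<rightarrow>\<^sub>E D. T y \<le> T x}"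

definition sup_induced_mean ::
    "nat \<Rightarrow> real set \<Rightarrow> ((nat \<Rightarrow> real) \<Rightarrow> real) \<Rightarrow> (nat \<Rightarrow> real) \<Rightarrow> (nat \<Rightarrow> real) \<Rightarrow> real" where
  "sup_induced_mean n D T x u = (SUP z \<in> sublevel n D T x. induced_mean n D z u)"

definition quantile :: "real \<Rightarrow> 'a measure \<Rightarrow> ('a \<Rightarrow> real) \<Rightarrow> real" where
  "quantile p M Y = Inf {y. p \<le> cdf (distr M borel Y) y}"

text \<open>The law of \<open>n\<close> independent uniform variables on \<open>[0,1]\<close>; its space is \<open>[0,1]\<^sup>n\<close>.\<close>

definition uniform_cube :: "nat \<Rightarrow> (nat \<Rightarrow> real) measure" where
  "uniform_cube n = (\<Pi>\<^sub>M i\<in>{1..n}. restrict_space lborel {0..1})"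

lemma prob_space_uniform_cube: "prob_space (uniform_cube n)"
  unfolding uniform_cube_def
  by (intro prob_space_PiM prob_spaceI)
     (simp add: emeasure_restrict_space space_restrict_space)

definition mean_bound ::
    "nat \<Rightarrow> real set \<Rightarrow> ((nat \<Rightarrow> real) \<Rightarrow> real) \<Rightarrow> real \<Rightarrow> (nat \<Rightarrow> real) \<Rightarrow> real" where
  "mean_bound n D T \<alpha> x = quantile (1 - \<alpha>) (uniform_cube n) (sup_induced_mean n D T x)"

text \<open>The topological support: the smallest closed set of full measure.\<close>

definition distr_support :: "real measure \<Rightarrow> real set" where
  "distr_support P = {x. \<forall>V. open V \<longrightarrow> x \<in> V \<longrightarrow> emeasure P V > 0}"

text \<open>
  For an arbitrary (possibly non-measurable) statistic \<open>T\<close> the event that the bound falls below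
  the mean need not be measurable, so its probability is to be taken as an outer probability
  \<^const>\<open>outer_measure_of\<close>; on measurable events this is the probability itself.
\<close>

end

theory Submission
  imports Defs
begin

text \<open>
  Write \<open>m\<close> for the induced mean and \<open>b\<close> for its supremum over a sublevel set. Bounding each \<open>y\<close>
  by the next larger order statistic of \<open>x\<close> gives \<open>\<mu> \<le> m(x, F(x))\<close> for every sample \<open>x\<close>. Hence
  \<open>T(X) \<le> T(x\<^sub>0)\<close> implies \<open>\<mu> \<le> b(x\<^sub>0, F(X))\<close>. As \<open>b(x\<^sub>0, \<cdot>)\<close> is antitone and the \<open>F(X\<^sub>i)\<close>
  stochastically dominate independent uniform variables, this has probability at most
  \<open>\<P>(\<mu> \<le> b(x\<^sub>0, U))\<close>, which is at most \<open>\<alpha>\<close> whenever the bound at \<open>x\<^sub>0\<close> is below \<open>\<mu>\<close>. The set of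
  samples whose bound is below \<open>\<mu>\<close> is an increasing union of countably many sublevel sets of this
  kind. The argument produces a measurable cover of it, so \<open>T\<close> need not be measurable.
\<close>

section \<open>Order statistics\<close>

text \<open>In a sorted list the entries at most \<open>c\<close> form an initial segment, as long
  as the filtered list.\<close>

lemma sorted_nth_le_iff_length_filter:
  fixes xs :: "'a::linorder list"
  assumes "sorted xs" "k < length xs"
  shows "xs ! k \<le> c \<longleftrightarrow> k < length (filter (\<lambda>x. x \<le> c) xs)"
  using assms
proof (induction xs arbitrary: k)
  case (Cons x xs)
  show ?case
  proof (cases "x \<le> c")
    case True
    with Cons show ?thesis by (cases k) auto
  next
    case False
    with Cons.prems have "filter (\<lambda>x. x \<le> c) (x # xs) = []"
      by (auto simp: filter_empty_conv)
    moreover have "x \<le> (x # xs) ! k"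
      using Cons.prems by (cases k) auto
    ultimately show ?thesis using False by auto
  qed
qed simp

text \<open>Replaces sorting by counting; monotonicity in the sample and measurability both follow
  from this form.\<close>

lemma order_stat_le_iff:
  assumes "i \<in> {1..n}"
  shows "order_stat n v i \<le> c \<longleftrightarrow> i \<le> card {j \<in> {1..n}. v j \<le> c}"
proof -
  let ?vs = "map v [1..<Suc n]"
  have "length (filter (\<lambda>x. x \<le> c) (sort ?vs)) = length (filter (\<lambda>x. x \<le> c) ?vs)"
    by (metis filter_sort length_sort)
  also have "\<dots> = length (filter (\<lambda>j. v j \<le> c) [1..<Suc n])"
    by (simp only: filter_map length_map o_def)
  also have "\<dots> = card {j \<in> {1..n}. v j \<le> c}"
    by (subst distinct_length_filter) (auto intro!: arg_cong[where f = card])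
  finally have len: "length (filter (\<lambda>x. x \<le> c) (sort ?vs)) = card {j \<in> {1..n}. v j \<le> c}" .
  have "sort ?vs ! (i - 1) \<le> c \<longleftrightarrow> i - 1 < length (filter (\<lambda>x. x \<le> c) (sort ?vs))"
    by (rule sorted_nth_le_iff_length_filter) (use assms in auto)
  also have "\<dots> \<longleftrightarrow> i \<le> card {j \<in> {1..n}. v j \<le> c}"
    unfolding len using assms by auto
  finally show ?thesis unfolding order_stat_def .
qed

lemma order_stat_mono_sample:
  assumes "i \<in> {1..n}" "\<And>j. j \<in> {1..n} \<Longrightarrow> v j \<le> w j"
  shows "order_stat n v i \<le> order_stat n w i"
proof -
  have "i \<le> card {j \<in> {1..n}. w j \<le> order_stat n w i}"
    using order_stat_le_iff[OF assms(1), of w] by blast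
  also have "\<dots> \<le> card {j \<in> {1..n}. v j \<le> order_stat n w i}"
    using assms(2) by (intro card_mono) (auto intro: order_trans)
  finally show ?thesis
    using order_stat_le_iff[OF assms(1)] by blast
qed

lemma order_stat_mono_index:
  assumes "1 \<le> i" "i \<le> j" "j \<le> n"
  shows "order_stat n v i \<le> order_stat n v j"
  unfolding order_stat_def using assms by (intro sorted_nth_mono) auto

lemma order_stat_in_sample:
  assumes "i \<in> {1..n}"
  shows "order_stat n v i \<in> v ` {1..n}"
proof -
  have "order_stat n v i \<in> set (sort (map v [1..<Suc n]))"
    unfolding order_stat_def using assms by (intro nth_mem) auto
  also have "\<dots> = v ` {1..n}" by (simp only: set_sort set_map set_upt atLeastLessThanSuc_atLeastAtMost)
  finally show ?thesis .
qed

text \<open>A nondecreasing map keeps a sorted list sorted, so it commutes with \<open>sort\<close>,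
  even if it creates ties.\<close>

lemma order_stat_mono_comp:
  fixes f :: "real \<Rightarrow> real"
  assumes "mono f" "i \<in> {1..n}"
  shows "order_stat n (\<lambda>j\<in>{1..n}. f (x j)) i = f (order_stat n x i)"
proof -
  let ?xs = "map x [1..<Suc n]"
  have 1: "map (\<lambda>j\<in>{1..n}. f (x j)) [1..<Suc n] = map f ?xs" by auto
  have 2: "sort (map f ?xs) = map f (sort ?xs)"
    by (rule properties_for_sort) (use assms in \<open>auto intro!: sorted_map_mono simp: mono_on_def monoD multiset.map_comp\<close>)
  show ?thesis
    unfolding order_stat_def 1 2 by (rule nth_map) (use assms(2) in auto)
qed

text \<open>By counting, the event that the order statistic is at most \<open>c\<close> compares
  \<open>i\<close> with a finite sum of measurable indicators.\<close>

lemma borel_measurable_order_stat: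
  assumes "i \<in> {1..n}" "\<And>j. j \<in> {1..n} \<Longrightarrow> (\<lambda>w. v w j) \<in> borel_measurable N"
  shows "(\<lambda>w. order_stat n (v w) i) \<in> borel_measurable N"
proof (rule borel_measurable_iff_le[THEN iffD2], rule allI)
  fix c
  note [measurable] = assms(2)
  have "real (card {j \<in> {1..n}. v w j \<le> c}) = (\<Sum>j\<in>{1..n}. indicator {..c} (v w j))" for w
    by (simp add: indicator_def sum.If_cases Int_def)
  then have "{w \<in> space N. order_stat n (v w) i \<le> c} =
      {w \<in> space N. real i \<le> (\<Sum>j\<in>{1..n}. indicator {..c} (v w j))}"
    by (simp only: order_stat_le_iff[OF assms(1)] flip: of_nat_le_iff[where 'a = real])
  also have "\<dots> \<in> sets N" by measurable
  finally show "{w \<in> space N. order_stat n (v w) i \<le> c} \<in> sets N" .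
qed

section \<open>Induced means\<close>

lemma ext_sample_mono:
  assumes "bdd_above D" "x \<in> {1..n} \<rightarrow>\<^sub>E D" "i \<in> {1..n}"
  shows "ext_sample n D x i \<le> ext_sample n D x (i + 1)"
proof (cases "i = n")
  case True
  have "order_stat n x i \<in> D"
    using order_stat_in_sample[OF assms(3), of x] assms(2) by auto
  then show ?thesis
    using True assms(1) by (auto simp: ext_sample_def intro: cSup_upper)
next
  case False
  with assms(3) show ?thesis
    by (auto simp: ext_sample_def intro: order_stat_mono_index)
qed

lemma ext_level_mono_sample:
  assumes "i \<in> {1..n}" "\<And>j. j \<in> {1..n} \<Longrightarrow> u j \<le> v j"
  shows "ext_level n u i \<le> ext_level n v i"
  using assms by (auto simp: ext_level_def intro: order_stat_mono_sample)

text \<open>In the summed-by-parts form \<open>induced_mean_alt\<close> the levels carry a minus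
  sign and multiply gaps of the extended sample, which are nonnegative by
  \<open>ext_sample_mono\<close>.\<close>

lemma induced_mean_antimono:
  assumes "bdd_above D" "x \<in> {1..n} \<rightarrow>\<^sub>E D" "\<And>j. j \<in> {1..n} \<Longrightarrow> u j \<le> v j"
  shows "induced_mean n D x v \<le> induced_mean n D x u"
  unfolding induced_mean_alt
  using assms ext_level_mono_sample[of _ n u v] ext_sample_mono[OF assms(1,2)]
  by (intro diff_left_mono sum_mono mult_right_mono) auto

lemma induced_mean_le_Sup:
  assumes "bdd_above D" "x \<in> {1..n} \<rightarrow>\<^sub>E D" "u \<in> {1..n} \<rightarrow>\<^sub>E {0..1}"
  shows "induced_mean n D x u \<le> Sup D"
proof -
  have "0 \<le> ext_level n u i" if "i \<in> {1..n}" for i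
    using order_stat_in_sample[OF that, of u] that assms(3)
    by (auto simp: ext_level_def dest!: PiE_mem)
  then have "0 \<le> (\<Sum>i=1..n. ext_level n u i * (ext_sample n D x (i + 1) - ext_sample n D x i))"
    using ext_sample_mono[OF assms(1,2)] by (intro sum_nonneg mult_nonneg_nonneg) auto
  then show ?thesis
    by (simp add: induced_mean_alt)
qed

text \<open>If \<open>j\<close> is the least index in \<open>{1..k+1}\<close> with
  \<open>y \<le> a j\<close>, exactly the summands from \<open>j\<close> on survive, and the
  right-hand side telescopes to \<open>a j\<close>.\<close>

lemma le_telescoped_indicator_sum:
  fixes a :: "nat \<Rightarrow> real"
  assumes "\<And>i. i \<in> {1..k} \<Longrightarrow> a i \<le> a (i + 1)" "y \<le> a (k + 1)"
  shows "y \<le> a (k + 1) - (\<Sum>i=1..k. indicator {..a i} y * (a (i + 1) - a i))"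
  using assms
proof (induction k)
  case (Suc k)
  show ?case
  proof (cases "y \<le> a (k + 1)")
    case True
    with Suc show ?thesis by simp
  next
    case False
    have "a i \<le> a (k + 1)" if "i \<in> {1..k}" for i
    proof -
      have "i \<le> k + 1" using that by auto
      then show ?thesis
      proof (induction rule: inc_induct)
        case (step m)
        then show ?case using Suc.prems(1)[of m] that by auto
      qed simp
    qed
    then have "(\<Sum>i=1..k. indicator {..a i} y * (a (i + 1) - a i)) = 0"
      using False by (intro sum.neutral) force
    then show ?thesis using False Suc.prems(2) by (simp add: indicator_def)
  qed
qed simp

text \<open>The bound \<open>le_telescoped_indicator_sum\<close>, taken at the extended sample, is
  integrated over \<open>P\<close>. Its top value is \<open>Sup D\<close>, which almost every
  \<open>y\<close> respects, and the indicator of \<open>{..c}\<close> integrates to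
  \<open>cdf P c\<close>.\<close>

lemma mean_le_induced_mean_cdf:
  assumes "real_distribution P" "integrable P (\<lambda>x. x)" "AE y in P. y \<in> D"
    and "bdd_above D" "x \<in> {1..n} \<rightarrow>\<^sub>E D"
  shows "(\<integral>y. y \<partial>P) \<le> induced_mean n D x (\<lambda>i\<in>{1..n}. cdf P (x i))"
proof -
  interpret real_distribution P by fact
  let ?a = "ext_sample n D x"
  let ?\<phi> = "\<lambda>y. Sup D - (\<Sum>i=1..n. indicator {..?a i} y * (?a (i + 1) - ?a i))"
  have [simp]: "integrable P (indicator {..c} :: real \<Rightarrow> real)" for c
    by (rule integrable_real_indicator) (auto simp: emeasure_eq_measure)
  have "(\<integral>y. y \<partial>P) \<le> (\<integral>y. ?\<phi> y \<partial>P)"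
  proof (rule integral_mono_AE)
    show "AE y in P. y \<le> ?\<phi> y"
      using assms(3)
    proof eventually_elim
      case (elim y)
      then have "y \<le> ?a (n + 1)"
        using assms(4) by (simp add: ext_sample_def cSup_upper)
      from le_telescoped_indicator_sum[OF ext_sample_mono[OF assms(4,5)] this]
      show ?case by (simp add: ext_sample_def)
    qed
    show "integrable P ?\<phi>"
      by (intro Bochner_Integration.integrable_diff Bochner_Integration.integrable_sum
          integrable_mult_left) simp_all
  qed (rule assms(2))
  also have "\<dots> = Sup D - (\<Sum>i=1..n. cdf P (?a i) * (?a (i + 1) - ?a i))"
    using prob_space by (simp add: cdf_def del: sum_mult_indicator sum_indicator_mult)
  \<comment> \<open>The cdf is nondecreasing, so its values at the order statistics of
    \<open>x\<close> are the order statistics of the levels.\<close>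
  also have "\<dots> = induced_mean n D x (\<lambda>i\<in>{1..n}. cdf P (x i))"
    unfolding induced_mean_alt
    using order_stat_mono_comp[of "cdf P" _ n x]
    by (auto intro!: sum.cong simp: ext_level_def ext_sample_def monoI cdf_nondecreasing)
  finally show ?thesis .
qed

section \<open>The supremum of the induced means\<close>

lemma space_uniform_cube: "space (uniform_cube n) = {1..n} \<rightarrow>\<^sub>E {0..1}"
  by (simp add: uniform_cube_def space_PiM space_restrict_space)

lemma borel_measurable_uniform_cube_component:
  assumes "i \<in> {1..n}"
  shows "(\<lambda>u. u i) \<in> borel_measurable (uniform_cube n)"
proof -
  have "(\<lambda>x. x) \<in> borel_measurable (restrict_space lborel {0..1::real})"
    by (rule measurable_restrict_space1) simp
  from measurable_comp[OF measurable_component_singleton[OF assms] this]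
  show ?thesis by (simp add: uniform_cube_def comp_def)
qed

lemma bdd_above_induced_mean:
  assumes "bdd_above D" "u \<in> space (uniform_cube n)"
  shows "bdd_above ((\<lambda>z. induced_mean n D z u) ` sublevel n D T x)"
  using induced_mean_le_Sup[OF assms(1)] assms(2)
  by (intro bdd_aboveI2[of _ _ "Sup D"]) (auto simp: space_uniform_cube sublevel_def)

lemma induced_mean_le_sup_induced_mean:
  assumes "bdd_above D" "u \<in> space (uniform_cube n)" "z \<in> sublevel n D T x"
  shows "induced_mean n D z u \<le> sup_induced_mean n D T x u"
  unfolding sup_induced_mean_def by (intro cSUP_upper assms bdd_above_induced_mean)

lemma sup_induced_mean_antimono:
  assumes "bdd_above D" "x \<in> {1..n} \<rightarrow>\<^sub>E D"
    and "u \<in> space (uniform_cube n)" "\<And>j. j \<in> {1..n} \<Longrightarrow> u j \<le> v j"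
  shows "sup_induced_mean n D T x v \<le> sup_induced_mean n D T x u"
  unfolding sup_induced_mean_def
proof (rule cSUP_mono)
  show "sublevel n D T x \<noteq> {}" using assms(2) by (auto simp: sublevel_def)
  show "\<exists>w\<in>sublevel n D T x. induced_mean n D z v \<le> induced_mean n D w u"
    if "z \<in> sublevel n D T x" for z
    using that induced_mean_antimono[OF assms(1) _ assms(4), of z]
    by (auto simp: sublevel_def)
qed (intro bdd_above_induced_mean assms)

text \<open>
  The induced mean is a continuous function of the extended sample, and a set of extended samples
  is separable, so the uncountable supremum is a countable one.
\<close>

lemma borel_measurable_sup_induced_mean:
  assumes "bdd_above D" "x \<in> {1..n} \<rightarrow>\<^sub>E D"
  shows "sup_induced_mean n D T x \<in> borel_measurable (uniform_cube n)"
proof -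
  let ?S = "sublevel n D T x" and ?a = "ext_sample n D"
  \<comment> \<open>Density refers to the product topology on functions; \<open>Z\<close> then
    selects samples whose extensions make up \<open>A\<close>.\<close>
  obtain A where A: "countable A" "A \<subseteq> ?a ` ?S" "?a ` ?S \<subseteq> closure A"
    by (rule separable)
  then obtain Z where Z: "countable Z" "Z \<subseteq> ?S" "A = ?a ` Z"
    by (metis countable_subset_image)
  have "x \<in> ?S" using assms(2) by (simp add: sublevel_def)
  with A(3) Z(3) have ne: "Z \<noteq> {}" by auto
  have bdd: "bdd_above ((\<lambda>z. induced_mean n D z u) ` Z)" if "u \<in> space (uniform_cube n)" for u
    using Z(2) by (intro bdd_above_mono[OF bdd_above_induced_mean[OF assms(1) that, of T x]]) auto
  have eq: "sup_induced_mean n D T x u = (SUP z\<in>Z. induced_mean n D z u)"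
    if u: "u \<in> space (uniform_cube n)" for u
  proof (rule antisym)
    \<comment> \<open>\<open>?\<phi>\<close> reads finitely many coordinates, so it is continuous,
      and a bound valid on \<open>A\<close> passes to its closure.\<close>
    let ?\<phi> = "\<lambda>a. \<Sum>i=1..n+1. a i * (ext_level n u i - ext_level n u (i - 1))"
    let ?s = "SUP z\<in>Z. induced_mean n D z u"
    have "closed {a. ?\<phi> a \<le> ?s}"
      by (intro closed_Collect_le continuous_intros continuous_on_product_coordinates)
    moreover have "A \<subseteq> {a. ?\<phi> a \<le> ?s}"
      using cSUP_upper[OF _ bdd[OF u]] by (auto simp: Z(3) induced_mean_def)
    ultimately have "?a ` ?S \<subseteq> {a. ?\<phi> a \<le> ?s}"
      using A(3) closure_minimal by blast
    then show "sup_induced_mean n D T x u \<le> ?s"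
      unfolding sup_induced_mean_def using \<open>x \<in> ?S\<close>
      by (intro cSUP_least) (auto simp: induced_mean_def)
    show "?s \<le> sup_induced_mean n D T x u"
      unfolding sup_induced_mean_def
      by (intro cSUP_subset_mono ne bdd_above_induced_mean assms(1) u Z(2)) auto
  qed
  have "(\<lambda>u. ext_level n u i) \<in> borel_measurable (uniform_cube n)" if "i \<le> n + 1" for i
  proof (cases "i = 0 \<or> i = n + 1")
    case False
    with that have "i \<in> {1..n}" by auto
    from borel_measurable_order_stat[OF this borel_measurable_uniform_cube_component] False
    show ?thesis by (auto simp: ext_level_def)
  qed (auto simp: ext_level_def)
  then have "(\<lambda>u. induced_mean n D z u) \<in> borel_measurable (uniform_cube n)" for z
    unfolding induced_mean_def
    by (intro borel_measurable_sum borel_measurable_times borel_measurable_diff) auto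
  then have "(\<lambda>u. SUP z\<in>Z. induced_mean n D z u) \<in> borel_measurable (uniform_cube n)"
    by (intro borel_measurable_cSUP Z(1) bdd)
  with eq show ?thesis by (simp cong: measurable_cong)
qed

section \<open>Quantiles and supports\<close>

text \<open>An infimum below \<open>c\<close> yields some \<open>y < c\<close> where the cdf has
  already reached \<open>p\<close>, and the events \<open>Y \<le> y\<close> and
  \<open>c \<le> Y\<close> are disjoint.\<close>

lemma (in prob_space) prob_ge_if_quantile_less:
  assumes Y: "Y \<in> borel_measurable M" and "p < 1" "quantile p M Y < c"
  shows "prob {w \<in> space M. c \<le> Y w} \<le> 1 - p"
proof -
  interpret Y: real_distribution "distr M borel Y"
    using Y by (simp add: prob_space_distr real_distribution_axioms_def real_distribution_def)
  \<comment> \<open>The infimum of an empty set would carry no information; the limit 1 of the cdf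
    exceeds \<open>p\<close>, so the set is inhabited.\<close>
  have "eventually (\<lambda>y. p < cdf (distr M borel Y) y) at_top"
    using Y.cdf_lim_at_top_prob assms(2) by (rule order_tendstoD)
  then have "{y. p \<le> cdf (distr M borel Y) y} \<noteq> {}"
    by (auto simp: eventually_at_top_linorder intro: less_imp_le)
  from cInf_lessD[OF this] assms(3) obtain y where y: "p \<le> cdf (distr M borel Y) y" "y < c"
    by (auto simp: quantile_def)
  have "cdf (distr M borel Y) y = prob {w \<in> space M. Y w \<le> y}"
    using Y by (auto simp: cdf_def measure_distr intro!: arg_cong[where f = prob])
  also have "\<dots> \<le> prob (space M - {w \<in> space M. c \<le> Y w})"
    using Y y(2) by (intro finite_measure_mono) auto
  also have "\<dots> = 1 - prob {w \<in> space M. c \<le> Y w}"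
    using Y by (intro prob_compl) measurable
  finally show ?thesis using y(1) by simp
qed

text \<open>The complement of the support is the union of all open null sets, and by Lindelof
  countably many of them have the same union.\<close>

lemma AE_distr_support:
  assumes "real_distribution P"
  shows "AE y in P. y \<in> distr_support P"
proof -
  interpret real_distribution P by fact
  let ?N = "{V. open V \<and> emeasure P V = 0}"
  obtain N where N: "N \<subseteq> ?N" "countable N" "\<Union>N = \<Union>?N"
    using Lindelof[of ?N] by auto
  have "V \<in> null_sets P" if "V \<in> N" for V
    using N(1) that by (intro null_setsI) auto
  then have "(\<Union>V\<in>N. V) \<in> null_sets P"
    by (intro null_sets_UN' N(2))
  then have "AE y in P. y \<notin> \<Union>N"
    using AE_not_in by force
  then show ?thesis
    by eventually_elim (auto simp: N(3) distr_support_def zero_less_iff_neq_zero)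
qed

text \<open>Inverse transform sampling on the closed interval. The inequality stops short of
  \<open>u = 1\<close>, a value that the cdf need not attain.\<close>

lemma distr_uniform_quantile:
  assumes "real_distribution P"
  obtains g where "g \<in> borel_measurable (restrict_space lborel {0..1::real})"
    and "distr (restrict_space lborel {0..1}) borel g = P"
    and "\<And>u. 0 \<le> u \<Longrightarrow> u < 1 \<Longrightarrow> u \<le> cdf P (g u)"
proof
  interpret cdf_distribution P
    using assms by (simp add: cdf_distribution_def)
  \<comment> \<open>\<open>I\<close> is the pseudoinverse of the cdf, meaningful on the open
    interval only. The default 0 at the endpoints affects a null set.\<close>
  define g where "g u = (if u \<in> {0<..<1} then I u else 0)" for u
  have g_borel: "g \<in> borel_measurable borel"
    unfolding g_def using measurable_CI by (subst measurable_restrict_space_iff[symmetric]) auto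
  then show g: "g \<in> borel_measurable (restrict_space lborel {0..1})"
    by (intro measurable_restrict_space1) simp
  show "u \<le> cdf P (g u)" if "0 \<le> u" "u < 1" for u
    using that pseudoinverse[of u "I u"] by (cases "u = 0") (auto simp: g_def cdf_nonneg)
  have "distr (restrict_space lborel {0..1}) borel g = distr (restrict_space lborel {0<..<1}) borel I"
  proof (rule measure_eqI)
    fix B assume "B \<in> sets (distr (restrict_space lborel {0..1}) borel g)"
    then have B: "B \<in> sets borel" by simp
    have I: "I \<in> borel_measurable (restrict_space lborel {0<..<1})"
      using measurable_CI by (simp cong: measurable_cong_sets sets_restrict_space_cong)
    have gB: "g -` B \<in> sets borel"
      using measurable_sets[OF g_borel B] by simp
    have "emeasure (distr (restrict_space lborel {0..1}) borel g) B = emeasure lborel (g -` B \<inter> {0..1})"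
      using B g by (simp add: emeasure_distr space_restrict_space emeasure_restrict_space)
    also have "\<dots> = emeasure lborel (g -` B \<inter> {0<..<1})"
    proof (rule emeasure_eq_AE)
      show "AE u in lborel. u \<in> g -` B \<inter> {0..1} \<longleftrightarrow> u \<in> g -` B \<inter> {0<..<1}"
        using AE_lborel_singleton[of 0] AE_lborel_singleton[of 1] by eventually_elim auto
    qed (use gB in auto)
    also have "g -` B \<inter> {0<..<1} = I -` B \<inter> {0<..<1}"
      by (auto simp: g_def)
    also have "emeasure lborel \<dots> = emeasure (distr (restrict_space lborel {0<..<1}) borel I) B"
      using B I by (simp add: emeasure_distr space_restrict_space emeasure_restrict_space)
    finally show "emeasure (distr (restrict_space lborel {0..1}) borel g) B =
      emeasure (distr (restrict_space lborel {0<..<1}) borel I) B" .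
  qed simp
  then show "distr (restrict_space lborel {0..1}) borel g = P"
    by (simp add: distr_I_eq_M)
qed

section \<open>The coverage guarantee\<close>

lemma outer_measure_of_le:
  assumes "A \<subseteq> B" "B \<in> sets M"
  shows "outer_measure_of M A \<le> emeasure M B"
  unfolding outer_measure_of_def using assms by (intro INF_lower) auto

text \<open>A maximiser, if there is one, gives a constant sequence. Otherwise values of
  \<open>T\<close> increase to a supremum that is not attained.\<close>

lemma countable_cofinal_incseq:
  fixes T :: "'a \<Rightarrow> real"
  assumes "A \<noteq> {}"
  obtains s :: "nat \<Rightarrow> 'a" where "range s \<subseteq> A" "incseq (\<lambda>k. T (s k))"
    "\<And>x. x \<in> A \<Longrightarrow> \<exists>k. T x \<le> T (s k)"
proof (cases "\<exists>m\<in>A. \<forall>x\<in>A. T x \<le> T m")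
  case True
  then obtain m where "m \<in> A" "\<forall>x\<in>A. T x \<le> T m" by blast
  then show ?thesis by (intro that[of "\<lambda>_. m"]) auto
next
  case False
  \<comment> \<open>Extended reals cover the case where \<open>T\<close> is unbounded on
    \<open>A\<close>.\<close>
  let ?T = "\<lambda>x. ereal (T x)"
  obtain f where f: "incseq f" "range f \<subseteq> ?T ` A" "Sup (?T ` A) = (SUP k. f k)"
    using Sup_countable_SUP[of "?T ` A"] assms by blast
  then have "\<forall>k. \<exists>x\<in>A. f k = ?T x" by blast
  then obtain s where s: "\<And>k. s k \<in> A" "\<And>k. f k = ?T (s k)" by metis
  show ?thesis
  proof (rule that[of s])
    show "range s \<subseteq> A" using s(1) by blast
    show "incseq (\<lambda>k. T (s k))" using f(1) by (simp add: s(2) incseq_def)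
    fix x assume "x \<in> A"
    with False obtain y where y: "y \<in> A" "T x < T y" by force
    then have "?T x < ?T y" by simp
    also have "?T y \<le> (SUP k. f k)" unfolding f(3)[symmetric] using y(1) by (rule SUP_upper)
    finally obtain k where "?T x < f k" by (auto simp: less_SUP_iff)
    then show "\<exists>k. T x \<le> T (s k)" by (auto simp: s(2) intro!: exI[of _ k])
  qed
qed

text \<open>
  The quantile transform \<open>g\<close> turns a uniform vector \<open>u\<close> into a sample, and \<open>u i \<le> F (g (u i))\<close>.
\<close>

lemma emeasure_PiM_cdf_le_uniform_cube:
  assumes "real_distribution P" "E \<in> sets (uniform_cube n)"
    and "\<And>u v. u \<in> space (uniform_cube n) \<Longrightarrow> v \<in> E \<Longrightarrow> (\<And>j. j \<in> {1..n} \<Longrightarrow> u j \<le> v j) \<Longrightarrow> u \<in> E"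
  shows "{x \<in> space (\<Pi>\<^sub>M i\<in>{1..n}. P). (\<lambda>i\<in>{1..n}. cdf P (x i)) \<in> E} \<in> sets (\<Pi>\<^sub>M i\<in>{1..n}. P)"
    and "emeasure (\<Pi>\<^sub>M i\<in>{1..n}. P) {x \<in> space (\<Pi>\<^sub>M i\<in>{1..n}. P). (\<lambda>i\<in>{1..n}. cdf P (x i)) \<in> E}
      \<le> emeasure (uniform_cube n) E"
proof -
  interpret cdf_distribution P
    using assms(1) by (simp add: cdf_distribution_def)
  let ?U = "restrict_space lborel {0..1::real}" and ?P = "\<Pi>\<^sub>M i\<in>{1..n}. P"
  let ?B = "{x \<in> space ?P. (\<lambda>i\<in>{1..n}. cdf P (x i)) \<in> E}"
  interpret U: prob_space ?U
    by (rule prob_spaceI) (simp add: emeasure_restrict_space space_restrict_space)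
  have "cdf P \<in> measurable P ?U"
    by (rule measurable_restrict_space2) (auto simp: cdf_nonneg cdf_bounded_prob)
  then have "(\<lambda>x. \<lambda>i\<in>{1..n}. cdf P (x i)) \<in> measurable ?P (uniform_cube n)"
    unfolding uniform_cube_def
    by (intro measurable_restrict measurable_compose[OF measurable_component_singleton])
  from measurable_sets[OF this assms(2)] show B: "?B \<in> sets ?P"
    by (simp add: vimage_def Int_def conj_commute)
  obtain g where g: "g \<in> borel_measurable ?U" "distr ?U borel g = P"
      "\<And>u. 0 \<le> u \<Longrightarrow> u < 1 \<Longrightarrow> u \<le> cdf P (g u)"
    using distr_uniform_quantile[OF assms(1)] by blast
  have gP: "g \<in> measurable ?U P" using g(1) by (simp cong: measurable_cong_sets)
  have "distr ?U P g = P" using g(2) by (metis distr_cong events_eq_borel)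
  \<comment> \<open>Applying \<open>g\<close> componentwise carries the uniform product to the
    product of copies of \<open>P\<close>.\<close>
  then have P_eq: "?P = distr (uniform_cube n) ?P (compose {1..n} g)"
    unfolding uniform_cube_def
    by (subst distr_PiM_finite_prob_space') (auto simp: gP U.prob_space_axioms prob_space_axioms)
  have comp: "compose {1..n} g \<in> measurable (uniform_cube n) ?P"
    unfolding uniform_cube_def compose_def
    by (intro measurable_restrict measurable_compose[OF _ gP] measurable_component_singleton)
  \<comment> \<open>The inequality for \<open>g\<close> may fail at a coordinate equal to 1, so that
    null event is discarded first.\<close>
  have less_1: "AE u in uniform_cube n. \<forall>i\<in>{1..n}. u i < 1"
  proof (rule AE_finite_allI)
    fix i assume i: "i \<in> {1..n}"
    have "AE u in ?U. u < 1"
      using AE_lborel_singleton[of 1] by (subst AE_restrict_space_iff) auto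
    then show "AE u in uniform_cube n. u i < 1"
      unfolding uniform_cube_def using i by (intro AE_PiM_component U.prob_space_axioms)
  qed simp
  have "emeasure ?P ?B = emeasure (uniform_cube n) (compose {1..n} g -` ?B \<inter> space (uniform_cube n))"
    by (subst P_eq, subst emeasure_distr[OF comp B]) simp
  also have "\<dots> \<le> emeasure (uniform_cube n) E"
  proof (rule emeasure_mono_AE)
    show "AE u in uniform_cube n. u \<in> compose {1..n} g -` ?B \<inter> space (uniform_cube n) \<longrightarrow> u \<in> E"
      using less_1
    proof eventually_elim
      case (elim u)
      show ?case
      proof
        assume u: "u \<in> compose {1..n} g -` ?B \<inter> space (uniform_cube n)"
        show "u \<in> E"
        \<comment> \<open>The vector of cdf values lies in \<open>E\<close> and dominates
          \<open>u\<close> componentwise; \<open>E\<close> is closed downwards.\<close>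
        proof (rule assms(3))
          show "(\<lambda>i\<in>{1..n}. cdf P (compose {1..n} g u i)) \<in> E" using u by simp
          show "u j \<le> (\<lambda>i\<in>{1..n}. cdf P (compose {1..n} g u i)) j" if "j \<in> {1..n}" for j
            using that u elim by (auto simp: compose_def space_uniform_cube dest!: PiE_mem intro!: g(3))
        qed (use u in simp)
      qed
    qed
  qed (rule assms(2))
  finally show "emeasure ?P ?B \<le> emeasure (uniform_cube n) E" .
qed

lemma sublevel_mono: "T x \<le> T y \<Longrightarrow> sublevel n D T x \<subseteq> sublevel n D T y"
  by (auto simp: sublevel_def)

lemma sample_mean_bound_event_cover:
  assumes P: "real_distribution P" "integrable P (\<lambda>x. x)" "\<mu> = (\<integral>x. x \<partial>P)"
    and D: "D = distr_support P" "bdd_above D" and \<alpha>: "0 < \<alpha>"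
  obtains B where "B \<in> sets (\<Pi>\<^sub>M i\<in>{1..n}. P)" "emeasure (\<Pi>\<^sub>M i\<in>{1..n}. P) B \<le> ennreal \<alpha>"
    "{x \<in> {1..n} \<rightarrow>\<^sub>E D. mean_bound n D T \<alpha> x < \<mu>} \<subseteq> B"
proof (cases "{x \<in> {1..n} \<rightarrow>\<^sub>E D. mean_bound n D T \<alpha> x < \<mu>} = {}")
  case True
  then show ?thesis by (intro that[of "{}"]) auto
next
  case False
  let ?A = "{x \<in> {1..n} \<rightarrow>\<^sub>E D. mean_bound n D T \<alpha> x < \<mu>}"
  interpret U: prob_space "uniform_cube n" by (rule prob_space_uniform_cube)
  interpret P: real_distribution P by fact
  \<comment> \<open>\<open>T\<close> need not attain a maximum on \<open>?A\<close>; the points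
    \<open>s k\<close> stand in for a maximiser.\<close>
  obtain s where s: "range s \<subseteq> ?A" "incseq (\<lambda>k. T (s k))" "\<And>x. x \<in> ?A \<Longrightarrow> \<exists>k. T x \<le> T (s k)"
    using countable_cofinal_incseq[OF False, where T = T] by blast
  then have sD: "s k \<in> {1..n} \<rightarrow>\<^sub>E D" and sb: "mean_bound n D T \<alpha> (s k) < \<mu>" for k by blast+
  define E where "E k = {u \<in> space (uniform_cube n). \<mu> \<le> sup_induced_mean n D T (s k) u}" for k
  have meas: "sup_induced_mean n D T (s k) \<in> borel_measurable (uniform_cube n)" for k
    by (intro borel_measurable_sup_induced_mean D(2) sD)
  then have E_sets: "E k \<in> sets (uniform_cube n)" for k
    unfolding E_def by measurable
  \<comment> \<open>The quantile level \<open>p = 1 - \<alpha>\<close> is below 1 because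
    \<open>\<alpha>\<close> is positive, and \<open>1 - p\<close> is
    \<open>\<alpha>\<close>.\<close>
  have E_le: "emeasure (uniform_cube n) (E k) \<le> ennreal \<alpha>" for k
    using U.prob_ge_if_quantile_less[OF meas, of "1 - \<alpha>" k \<mu>] sb[of k] \<alpha>
    by (simp add: E_def mean_bound_def U.emeasure_eq_measure)
  have "incseq E"
  proof (rule incseq_SucI, rule subsetI)
    fix k u assume u: "u \<in> E k"
    have "sublevel n D T (s k) \<subseteq> sublevel n D T (s (Suc k))"
      by (intro sublevel_mono incseq_SucD[OF s(2)])
    moreover have "s k \<in> sublevel n D T (s k)" using sD by (simp add: sublevel_def)
    ultimately have "sup_induced_mean n D T (s k) u \<le> sup_induced_mean n D T (s (Suc k)) u"
      unfolding sup_induced_mean_def using u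
      by (intro cSUP_subset_mono bdd_above_induced_mean D(2)) (auto simp: E_def)
    with u show "u \<in> E (Suc k)" by (auto simp: E_def)
  qed
  \<comment> \<open>Continuity from below preserves the common bound \<open>\<alpha>\<close>, where
    adding up the measures would not.\<close>
  then have "emeasure (uniform_cube n) (\<Union>k. E k) = (SUP k. emeasure (uniform_cube n) (E k))"
    using E_sets by (intro SUP_emeasure_incseq[symmetric]) auto
  also have "\<dots> \<le> ennreal \<alpha>" using E_le by (rule SUP_least)
  finally have UE_le: "emeasure (uniform_cube n) (\<Union>k. E k) \<le> ennreal \<alpha>" .
  let ?B = "{x \<in> space (\<Pi>\<^sub>M i\<in>{1..n}. P). (\<lambda>i\<in>{1..n}. cdf P (x i)) \<in> (\<Union>k. E k)}"
  have down: "u \<in> (\<Union>k. E k)"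
    if u: "u \<in> space (uniform_cube n)" and v: "v \<in> (\<Union>k. E k)"
      and le: "\<And>j. j \<in> {1..n} \<Longrightarrow> u j \<le> v j" for u v
  proof -
    obtain k where "\<mu> \<le> sup_induced_mean n D T (s k) v" using v by (auto simp: E_def)
    also have "\<dots> \<le> sup_induced_mean n D T (s k) u"
      by (intro sup_induced_mean_antimono D(2) sD u le)
    finally show ?thesis using u by (auto simp: E_def)
  qed
  have UE_sets: "(\<Union>k. E k) \<in> sets (uniform_cube n)" using E_sets by auto
  show ?thesis
  proof (rule that)
    show "?B \<in> sets (\<Pi>\<^sub>M i\<in>{1..n}. P)"
      by (rule emeasure_PiM_cdf_le_uniform_cube(1)[OF P(1) UE_sets down])
    show "emeasure (\<Pi>\<^sub>M i\<in>{1..n}. P) ?B \<le> ennreal \<alpha>"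
      by (rule order_trans[OF emeasure_PiM_cdf_le_uniform_cube(2)[OF P(1) UE_sets down] UE_le])
    show "?A \<subseteq> ?B"
    proof
      fix x assume x: "x \<in> ?A"
      then obtain k where k: "T x \<le> T (s k)" using s(3) by blast
      let ?u = "\<lambda>i\<in>{1..n}. cdf P (x i)"
      have u: "?u \<in> space (uniform_cube n)"
        by (auto simp: space_uniform_cube P.cdf_nonneg P.cdf_bounded_prob)
      have "\<mu> \<le> induced_mean n D x ?u"
        unfolding P(3) using x AE_distr_support[OF P(1)]
        by (intro mean_le_induced_mean_cdf P(1,2) D(2)) (auto simp: D(1))
      \<comment> \<open>Since \<open>T x \<le> T (s k)\<close>, the sample \<open>x\<close> itself
        competes in the supremum at \<open>s k\<close>.\<close>
      also have "\<dots> \<le> sup_induced_mean n D T (s k) ?u"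
        using x k by (intro induced_mean_le_sup_induced_mean D(2) u) (auto simp: sublevel_def)
      finally have "?u \<in> E k" using u by (simp add: E_def)
      moreover have "x \<in> space (\<Pi>\<^sub>M i\<in>{1..n}. P)" using x by (auto simp: space_PiM PiE_iff)
      ultimately show "x \<in> ?B" by blast
    qed
  qed
qed

theorem theorem2p7:
  fixes P :: "real measure" and F :: "real \<Rightarrow> real" and \<mu> :: real and D :: "real set"
    and M :: "'a measure" and X :: "nat \<Rightarrow> 'a \<Rightarrow> real" and n :: nat
    and T :: "(nat \<Rightarrow> real) \<Rightarrow> real" and \<alpha> :: real
  assumes "real_distribution P" and "F = cdf P"
    and "integrable P (\<lambda>x. x)" and "\<mu> = (\<integral>x. x \<partial>P)"
    and "D = distr_support P" and "bdd_above D"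
    and "n \<ge> 1"
    and "prob_space M"
    and "prob_space.indep_vars M (\<lambda>_. borel) X {1..n}"
    and "\<And>i. i \<in> {1..n} \<Longrightarrow> cdf (distr M borel (X i)) = F"
    and "0 < \<alpha>" and "\<alpha> < 1"
  shows "outer_measure_of M
           {\<omega> \<in> space M. mean_bound n D T \<alpha> (\<lambda>i\<in>{1..n}. X i \<omega>) < \<mu>} \<le> ennreal \<alpha>"
proof -
  interpret prob_space M by fact
  interpret P: real_distribution P by fact
  let ?X = "\<lambda>\<omega>. \<lambda>i\<in>{1..n}. X i \<omega>" and ?P = "\<Pi>\<^sub>M i\<in>{1..n}. P"
  have rv: "X i \<in> borel_measurable M" if "i \<in> {1..n}" for i
    using assms(9) that by (auto simp: indep_vars_def)
  have law: "distr M borel (X i) = P" if "i \<in> {1..n}" for i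
  proof (rule cdf_unique)
    show "real_distribution (distr M borel (X i))"
      using rv[OF that]
      by (simp add: prob_space_distr real_distribution_axioms_def real_distribution_def)
  qed (use assms that in auto)
  have X: "?X \<in> measurable M ?P"
    using rv by (intro measurable_restrict) (simp cong: measurable_cong_sets)
  have "distr M (\<Pi>\<^sub>M i\<in>{1..n}. borel) ?X = (\<Pi>\<^sub>M i\<in>{1..n}. distr M borel (X i))"
    using indep_vars_iff_distr_eq_PiM'[of "{1..n}" X "\<lambda>_. borel"] rv assms(7,9) by auto
  moreover have "(\<Pi>\<^sub>M i\<in>{1..n}. distr M borel (X i)) = ?P"
    using law by (intro PiM_cong) auto
  \<comment> \<open>\<open>P\<close> and \<open>borel\<close> have the same measurable sets, so both
    products carry the same sigma-algebra.\<close>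
  moreover have "distr M (\<Pi>\<^sub>M i\<in>{1..n}. borel) ?X = distr M ?P ?X"
    by (intro distr_cong sets_PiM_cong) auto
  ultimately have joint_law: "distr M ?P ?X = ?P" by simp
  obtain B where B: "B \<in> sets ?P" "emeasure ?P B \<le> ennreal \<alpha>"
      "{x \<in> {1..n} \<rightarrow>\<^sub>E D. mean_bound n D T \<alpha> x < \<mu>} \<subseteq> B"
    using sample_mean_bound_event_cover[OF assms(1,3,4,5,6,11)] by blast
  \<comment> \<open>The cover concerns samples with all entries in \<open>D\<close>; outcomes that
    leave \<open>D\<close> are absorbed into a null set \<open>N\<close>.\<close>
  have "AE \<omega> in M. \<forall>i\<in>{1..n}. X i \<omega> \<in> D"
  proof (rule AE_finite_allI)
    fix i assume i: "i \<in> {1..n}"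
    have "AE y in distr M borel (X i). y \<in> D"
      unfolding law[OF i] assms(5) by (rule AE_distr_support[OF assms(1)])
    then show "AE \<omega> in M. X i \<omega> \<in> D"
      by (rule AE_distrD[OF rv[OF i]])
  qed simp
  then obtain N where N: "{\<omega> \<in> space M. \<not> (\<forall>i\<in>{1..n}. X i \<omega> \<in> D)} \<subseteq> N" "N \<in> null_sets M"
    by (auto simp: eventually_ae_filter)
  let ?B = "?X -` B \<inter> space M"
  have XB: "?B \<in> sets M" by (rule measurable_sets[OF X B(1)])
  have "{\<omega> \<in> space M. mean_bound n D T \<alpha> (?X \<omega>) < \<mu>} \<subseteq> ?B \<union> N"
    using N(1) B(3) by (fastforce simp: PiE_iff)
  then have "outer_measure_of M {\<omega> \<in> space M. mean_bound n D T \<alpha> (?X \<omega>) < \<mu>} \<le> emeasure M (?B \<union> N)"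
    using XB N(2) by (intro outer_measure_of_le) auto
  also have "\<dots> = emeasure M ?B"
    using XB N(2) by (rule emeasure_Un_null_set)
  also have "\<dots> = emeasure ?P B"
    using emeasure_distr[OF X B(1)] unfolding joint_law by (rule sym)
  finally show ?thesis using B(2) by simp
qed

end
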